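(* For every integer $d\ge 1$ there exists a constant $c_d$ (depending only on $d$) such that for every rearrangement $f\mapsto f^*$ on $\mathbb{Z}^d$ defined by an enumeration respecting the $\ell^1$-norm, all $1\le p\le\infty$ and all $f:\mathbb{Z}^d\to\mathbb{R}$ vanishing at infinity, $$\|\nabla f^*\|_{L^p(\mathbb{Z}^d)}\le c_d\cdot\|\nabla f\|_{L^p(\mathbb{Z}^d)},$$ where the inequality is understood in $[0,\infty]$.
   Context: $\mathbb{Z}^d$ carries the standard lattice graph structure: $x\sim y$ if and only if $\|x-y\|_{\ell^1}=1$. For $g:\mathbb{Z}^d\to\mathbb{R}$ and $1\le p<\infty$, $\|\nabla g\|_{L^p}^p=\sum_{x\sim y}|g(x)-g(y)|^p$ (the sum runs once over each undirected edge), and $\|\nabla g\|_{L^\infty}=\sup_{x\sim y}|g(x)-g(y)|$. A function $f$ vanishes at infinity if $\{x:|f(x)|>t\}$ is finite for every $t>0$. An enumeration $v_1,v_2,\dots$ of $\mathbb{Z}^d$ (each point occurring exactly once) respects the $\ell^1$-norm if $\|v_i\|_{\ell^1}<\|v_j\|_{\ell^1}$ implies $i<j$; points with the same $\ell^1$-norm may be ordered arbitrarily. The rearrangement defined by the enumeration is $f^*(v_k):=$ the $k$-th largest value assumed by $|f|$, counted with multiplicity (that is, the largest $t\ge 0$ such that $|f(x)|\ge t$ for at least $k$ points $x$). *)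

theory Defs
  imports "HOL-Analysis.Analysis"
begin

text \<open>
  The lattice of dimension \<open>d\<close> is the type \<open>int ^ 'n\<close> with \<open>d = CARD('n)\<close>, so that \<open>d \<ge> 1\<close>.
\<close>

definition l1_norm :: "int ^ 'n \<Rightarrow> int" where
  "l1_norm x = (\<Sum>i\<in>UNIV. \<bar>x $ i\<bar>)"

definition adjacent :: "int ^ 'n \<Rightarrow> int ^ 'n \<Rightarrow> bool" where
  "adjacent x y \<longleftrightarrow> l1_norm (x - y) = 1"

text \<open>An undirected edge is the set of its two endpoints.\<close>

definition edges :: "(int ^ 'n) set set" where
  "edges = {{x, y} | x y. adjacent x y}"

definition edge_diff :: "(int ^ 'n \<Rightarrow> real) \<Rightarrow> (int ^ 'n) set \<Rightarrow> real" where
  "edge_diff g e = Max (g ` e) - Min (g ` e)"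

lemma edge_diff_doubleton: "edge_diff g {x, y} = \<bar>g x - g y\<bar>"
  by (auto simp: edge_diff_def max_def min_def)

definition ennreal_powr :: "ennreal \<Rightarrow> real \<Rightarrow> ennreal" where
  "ennreal_powr a r = (if a = \<infinity> then \<infinity> else ennreal (enn2real a powr r))"

definition grad_norm :: "ennreal \<Rightarrow> (int ^ 'n \<Rightarrow> real) \<Rightarrow> ennreal" where
  "grad_norm p g =
    (if p = \<infinity> then (SUP e\<in>edges. ennreal (edge_diff g e))
     else ennreal_powr (\<Sum>\<^sub>\<infinity>e\<in>edges. ennreal (edge_diff g e powr enn2real p)) (1 / enn2real p))"

definition vanishes_at_infinity :: "(int ^ 'n \<Rightarrow> real) \<Rightarrow> bool" where
  "vanishes_at_infinity f \<longleftrightarrow> (\<forall>t>0. finite {x. \<bar>f x\<bar> > t})"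

text \<open>
  Enumerations \<open>v 1, v 2, \<dots>\<close> are indexed from 1; the value \<open>v 0\<close> is irrelevant.
\<close>

definition enumeration_respecting_l1 :: "(nat \<Rightarrow> int ^ 'n) \<Rightarrow> bool" where
  "enumeration_respecting_l1 v \<longleftrightarrow>
    bij_betw v {1..} UNIV \<and>
    (\<forall>i\<ge>1. \<forall>j\<ge>1. l1_norm (v i) < l1_norm (v j) \<longrightarrow> i < j)"

text \<open>
  ``At least \<open>k\<close> points'' is expressed by a \<open>k\<close>-element subset, because the superlevel set at
  \<open>t = 0\<close> is infinite. If \<open>f\<close> vanishes at infinity, the greatest such \<open>t\<close> exists.
\<close>

definition kth_largest :: "(int ^ 'n \<Rightarrow> real) \<Rightarrow> nat \<Rightarrow> real" where
  "kth_largest f k =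
    (GREATEST t. 0 \<le> t \<and> (\<exists>A. finite A \<and> card A = k \<and> (\<forall>x\<in>A. t \<le> \<bar>f x\<bar>)))"

definition rearrangement :: "(nat \<Rightarrow> int ^ 'n) \<Rightarrow> (int ^ 'n \<Rightarrow> real) \<Rightarrow> int ^ 'n \<Rightarrow> real" where
  "rearrangement v f x = kth_largest f (inv_into {1..} v x)"

end

theory Submission
  imports Defs
begin

text \<open>
  Let \<open>a\<^sub>1 \<ge> a\<^sub>2 \<ge> \<dots>\<close> be the values of \<open>\<bar>f\<bar>\<close> in decreasing order, and let \<open>\<beta> n\<close> and \<open>\<sigma> n\<close> be the
  numbers of lattice points of norm \<open>< n\<close> and \<open>= n\<close>. The proof compares both gradients with the
  drops \<open>\<delta> n = a\<^bsub>\<beta> n + 1\<^esub> - a\<^bsub>\<beta> (n + 1) + 1\<^esub>\<close> of the sequence across the spheres.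

  Above, the points of norm \<open>n\<close> carry the indices \<open>\<beta> n + 1, \<dots>, \<beta> (n + 1)\<close>, so an edge whose
  endpoint closer to the origin has norm \<open>n\<close> contributes at most \<open>\<delta> n + \<delta> (n + 1)\<close> to the gradient
  of \<open>f\<^sup>*\<close>. There are \<open>O (\<sigma> n)\<close> such edges, and \<open>\<sigma>\<close> is nondecreasing, so \<open>\<parallel>\<nabla>f\<^sup>*\<parallel>\<^sub>p\<^sup>p\<close> is at most a constant
  times \<open>\<Sum>n. \<sigma> n * (\<delta> n)\<^sup>p\<close>.

  Below, isoperimetry enters: a set \<open>A\<close> with \<open>\<beta> n < card A \<le> \<beta> (n + 1)\<close> has at least
  \<open>\<sigma> n / (16 d\<^sup>2)\<close> outer neighbours (\<open>sphere_card_le_outer_boundary\<close>). Apply this to \<open>i\<close> points where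
  \<open>\<bar>f\<bar>\<close> is at least \<open>a\<^sub>i\<close>. If \<open>j - i\<close> is at most about half the number of neighbours, then fewer
  than half of the neighbours can carry values above \<open>a\<^sub>j\<close> (when \<open>a\<^sub>j < a\<^sub>i\<close>), so edges in a
  number that is a fixed fraction of \<open>\<sigma> n\<close> lead from values \<open>\<ge> a\<^sub>i\<close> to values \<open>\<le> a\<^sub>j\<close>
  (\<open>many_crossing_edges\<close>). Each drop \<open>\<delta> n\<close> splits into a bounded number \<open>K\<close> of such steps
  (\<open>level_refinement\<close>). The steps are disjoint intervals of values, so the steps crossed by one
  edge add up to at most the difference of \<open>\<bar>f\<bar>\<close> along it, and since
  \<open>\<Sum>x\<^sub>i\<^sup>p \<le> (\<Sum>x\<^sub>i)\<^sup>p\<close> for \<open>p \<ge> 1\<close> all steps together are paid for by \<open>\<parallel>\<nabla>f\<parallel>\<^sub>p\<^sup>p\<close>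
  (\<open>sum_crossings_le\<close>). For \<open>p = \<infinity>\<close> a single crossing edge bounds each step by \<open>\<parallel>\<nabla>f\<parallel>\<^sub>\<infinity>\<close>. All constants
  enter as \<open>C\<^sup>p\<close> or as \<open>C \<le> C\<^sup>p\<close>, hence the final constant does not depend on \<open>p\<close>.
\<close>

section \<open>Balls and spheres of the \<open>\<ell>\<^sup>1\<close>-norm\<close>

text \<open>
  The balls are open, so that the points of norm \<open>n\<close> occupy the positions after the first
  \<open>ball_card n\<close> in every enumeration that respects the norm.
\<close>

definition ball_card :: "'n::finite itself \<Rightarrow> nat \<Rightarrow> nat" where
  "ball_card TYPE('n) n = card {x :: int ^ 'n. l1_norm x < int n}"

definition sphere_card :: "'n::finite itself \<Rightarrow> nat \<Rightarrow> nat" where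
  "sphere_card TYPE('n) n = card {x :: int ^ 'n. l1_norm x = int n}"

lemma l1_norm_nonneg [simp]: "0 \<le> l1_norm x"
  by (simp add: l1_norm_def sum_nonneg)

lemma l1_norm_zero [simp]: "l1_norm 0 = 0"
  by (simp add: l1_norm_def)

lemma l1_norm_eq_0_iff [simp]: "l1_norm x = 0 \<longleftrightarrow> x = 0"
  by (simp add: l1_norm_def sum_nonneg_eq_0_iff vec_eq_iff)

lemma l1_norm_minus_commute: "l1_norm (x - y) = l1_norm (y - x)"
  by (simp add: l1_norm_def abs_minus_commute)

lemma l1_norm_triangle: "l1_norm (x + y) \<le> l1_norm x + l1_norm y"
  unfolding l1_norm_def sum.distrib [symmetric]
  by (intro sum_mono) (simp add: abs_triangle_ineq)

lemma abs_component_le_l1_norm: "\<bar>x $ i\<bar> \<le> l1_norm x"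
  unfolding l1_norm_def by (rule member_le_sum) auto

lemma l1_norm_add_axis: "l1_norm (x + axis i t) = l1_norm x + (\<bar>x $ i + t\<bar> - \<bar>x $ i\<bar>)"
proof -
  have "l1_norm (x + axis i t) = \<bar>x $ i + t\<bar> + (\<Sum>j\<in>UNIV - {i}. \<bar>x $ j\<bar>)"
    unfolding l1_norm_def by (subst sum.remove [of _ i]) (auto simp: axis_def intro!: sum.cong)
  moreover have "l1_norm x = \<bar>x $ i\<bar> + (\<Sum>j\<in>UNIV - {i}. \<bar>x $ j\<bar>)"
    unfolding l1_norm_def by (subst sum.remove [of _ i]) auto
  ultimately show ?thesis by simp
qed

lemma l1_norm_axis [simp]: "l1_norm (axis i t) = \<bar>t\<bar>"
  using l1_norm_add_axis [of 0 i t] by simp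

lemma finite_l1_norm_le: "finite {x :: int ^ 'n. l1_norm x \<le> r}"
proof (rule finite_subset)
  show "{x :: int ^ 'n. l1_norm x \<le> r} \<subseteq> vec_lambda ` (UNIV \<rightarrow>\<^sub>E {-r..r})"
  proof
    fix x :: "int ^ 'n"
    assume x: "x \<in> {x. l1_norm x \<le> r}"
    have "x $ i \<in> {-r..r}" for i
      using abs_component_le_l1_norm [of x i] x by (simp add: abs_le_iff)
    then have "vec_nth x \<in> UNIV \<rightarrow>\<^sub>E {-r..r}" by auto
    then show "x \<in> vec_lambda ` (UNIV \<rightarrow>\<^sub>E {-r..r})"
      by (metis image_eqI vec_nth_inverse)
  qed
  show "finite (vec_lambda ` (UNIV \<rightarrow>\<^sub>E {-r..r}) :: (int ^ 'n) set)"
    by (intro finite_imageI finite_PiE) auto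
qed

lemma finite_l1_norm_less: "finite {x :: int ^ 'n. l1_norm x < r}"
  by (rule finite_subset [OF _ finite_l1_norm_le [of r]]) auto

lemma finite_l1_norm_eq: "finite {x :: int ^ 'n. l1_norm x = r}"
  by (rule finite_subset [OF _ finite_l1_norm_le [of r]]) auto

lemma ball_card_0 [simp]: "ball_card TYPE('n::finite) 0 = 0"
proof -
  have "{x :: int ^ 'n. l1_norm x < int 0} = {}"
    by (auto simp: not_less)
  then show ?thesis by (simp only: ball_card_def card.empty)
qed

lemma sphere_card_0 [simp]: "sphere_card TYPE('n::finite) 0 = 1"
  by (simp add: sphere_card_def)

lemma ball_card_Suc: "ball_card TYPE('n::finite) (Suc n) = ball_card TYPE('n) n + sphere_card TYPE('n) n"
proof -
  have "{x :: int ^ 'n. l1_norm x < int (Suc n)} = {x. l1_norm x < int n} \<union> {x. l1_norm x = int n}"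
    by auto
  then show ?thesis
    unfolding ball_card_def sphere_card_def
    by (simp only:) (rule card_Un_disjoint, auto simp: finite_l1_norm_less finite_l1_norm_eq)
qed

text \<open>Pushing one coordinate away from zero embeds each sphere into the next one.\<close>

lemma sphere_card_mono: "sphere_card TYPE('n::finite) n \<le> sphere_card TYPE('n) (Suc n)"
proof -
  fix i :: 'n
  define push where "push x = x + axis i (if 0 \<le> x $ i then 1 else - 1)" for x :: "int ^ 'n"
  have comp: "push x $ j = (if j = i then x $ i + (if 0 \<le> x $ i then 1 else - 1) else x $ j)" for x j
    by (simp add: push_def axis_def)
  have "inj push"
  proof (rule injI, rule vec_eq_iff [THEN iffD2], rule allI)
    fix x y j
    assume eq: "push x = push y"
    have "push x $ i = push y $ i" "push x $ j = push y $ j"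
      using eq by simp_all
    then show "x $ j = y $ j"
      unfolding comp by (auto split: if_splits)
  qed
  moreover have "l1_norm (push x) = l1_norm x + 1" for x
    unfolding push_def l1_norm_add_axis by auto
  ultimately show ?thesis
    unfolding sphere_card_def
    by (intro card_inj_on_le [of push] finite_l1_norm_eq) (auto intro: inj_on_subset)
qed

lemma sphere_card_pos: "0 < sphere_card TYPE('n::finite) n"
proof (induction n)
  case (Suc n)
  then show ?case using sphere_card_mono [where 'n = 'n, of n] by linarith
qed simp

text \<open>
  A ball of radius \<open>3 n + 1\<close> contains two disjoint translates of the ball of radius \<open>n\<close>. It
  serves as the set of translations in the isoperimetric argument, which needs twice as many
  translations as points.
\<close>

lemma ball_card_double:
  "2 * ball_card TYPE('n::finite) (Suc n) \<le> ball_card TYPE('n) (3 * n + 2)"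
proof -
  fix i :: 'n
  define B where "B = {x :: int ^ 'n. l1_norm x < int (Suc n)}"
  define shift where "shift x = x + axis i (int (2 * n + 1))" for x :: "int ^ 'n"
  have fin: "finite B"
    unfolding B_def by (rule finite_l1_norm_less)
  have "inj shift"
    by (simp add: shift_def inj_def)
  then have "card (shift ` B) = card B"
    by (simp add: card_image inj_on_subset)
  moreover have "B \<inter> shift ` B = {}"
  proof -
    have "shift x \<notin> B" if "x \<in> B" for x
    proof
      assume "shift x \<in> B"
      then have "\<bar>x $ i + int (2 * n + 1)\<bar> \<le> int n"
        using abs_component_le_l1_norm [of "shift x" i] by (simp add: B_def shift_def)
      moreover have "\<bar>x $ i\<bar> \<le> int n"
        using that abs_component_le_l1_norm [of x i] by (simp add: B_def)
      ultimately show False by linarith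
    qed
    then show ?thesis by blast
  qed
  ultimately have "card (B \<union> shift ` B) = 2 * card B"
    using fin by (simp add: card_Un_disjoint)
  moreover have "l1_norm (shift x) < int (3 * n + 2)" if "x \<in> B" for x
    using that l1_norm_triangle [of x "axis i (int (2 * n + 1))"] by (simp add: B_def shift_def)
  then have "B \<union> shift ` B \<subseteq> {x. l1_norm x < int (3 * n + 2)}"
    by (auto simp: B_def)
  then have "card (B \<union> shift ` B) \<le> ball_card TYPE('n) (3 * n + 2)"
    unfolding ball_card_def by (intro card_mono finite_l1_norm_less)
  ultimately show ?thesis
    by (simp add: ball_card_def B_def)
qed

text \<open>
  Every point of norm \<open>n\<close> has a coordinate of modulus at least \<open>n / d\<close>. Moving this coordinate
  towards zero by \<open>1, \<dots>, \<lceil>n / d\<rceil>\<close> steps gives points of the ball; the resulting point, together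
  with the coordinate and its sign, determines the original point, because the number of steps
  is the loss of norm.
\<close>

lemma radius_times_sphere_card_le:
  "n * sphere_card TYPE('n::finite) n \<le> 2 * CARD('n)\<^sup>2 * ball_card TYPE('n) n"
proof -
  define d where "d = CARD('n)"
  define m where "m = (n + d - 1) div d"
  have d: "0 < d" by (simp add: d_def)
  have n_le: "n \<le> d * m"
    unfolding m_def using d dividend_less_times_div [of d "n + d - 1"]
    by linarith
  define S where "S = {x :: int ^ 'n. l1_norm x = int n}"
  define B where "B = {x :: int ^ 'n. l1_norm x < int n}"
  have "\<exists>i. int m \<le> \<bar>x $ i\<bar>" if "x \<in> S" for x
  proof (rule ccontr)
    assume "\<not> ?thesis"
    then have less: "\<bar>x $ i\<bar> \<le> int m - 1" for i
      by (metis linorder_not_le zle_diff1_eq)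
    have "l1_norm x \<le> (\<Sum>i\<in>(UNIV :: 'n set). int m - 1)"
      unfolding l1_norm_def by (rule sum_mono) (rule less)
    then have "int n \<le> int d * (int m - 1)"
      using that by (simp add: S_def d_def)
    then have le: "int n + int d \<le> int d * int m"
      by (simp add: algebra_simps)
    have "d * m \<le> n + d - 1"
      unfolding m_def by simp
    then have "int d * int m \<le> int (n + d - 1)"
      by (metis of_nat_le_iff of_nat_mult)
    then show False using le d by linarith
  qed
  then obtain c where c: "\<And>x. x \<in> S \<Longrightarrow> int m \<le> \<bar>x $ c x\<bar>"
    by metis
  \<comment> \<open>Moving by all of \<open>\<bar>x $ c x\<bar>\<close> may destroy the sign, so it is recorded separately.\<close>
  define h where
    "h = (\<lambda>(x :: int ^ 'n, j). (x + axis (c x) (- sgn (x $ c x) * int j), c x, x $ c x \<ge> 0))"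
  have norm_h: "l1_norm (x + axis (c x) (- sgn (x $ c x) * int j)) = int n - int j"
    if "x \<in> S" "j \<in> {1..m}" for x j
    unfolding l1_norm_add_axis using that c [OF that(1)]
    by (auto simp: S_def sgn_if)
  have nz: "x $ c x \<noteq> 0" if "x \<in> S" "j \<in> {1..m}" for x and j :: nat
    using that c [OF that(1)] by auto
  have "inj_on h (S \<times> {1..m})"
  proof (rule inj_onI)
    fix q r
    assume "q \<in> S \<times> {1..m}" "r \<in> S \<times> {1..m}" "h q = h r"
    then obtain x j y k where q: "q = (x, j)" "r = (y, k)"
      and x: "x \<in> S" "j \<in> {1..m}" and y: "y \<in> S" "k \<in> {1..m}" and eq: "h (x, j) = h (y, k)"
      by auto
    have "int n - int j = int n - int k"
      using norm_h [OF x] norm_h [OF y] eq by (metis (no_types, lifting) case_prod_conv h_def prod.inject)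
    then have "j = k" by simp
    moreover have "sgn (x $ c x) = sgn (y $ c y)" "c x = c y"
      using eq nz [OF x] nz [OF y] by (auto simp: h_def sgn_if)
    ultimately show "q = r"
      using eq by (simp add: q h_def)
  qed
  moreover have "h ` (S \<times> {1..m}) \<subseteq> B \<times> (UNIV :: ('n \<times> bool) set)"
    using norm_h by (auto simp: h_def B_def)
  moreover have "finite (B \<times> (UNIV :: ('n \<times> bool) set))"
    by (simp add: B_def finite_l1_norm_less)
  ultimately have "card (S \<times> {1..m}) \<le> card (B \<times> (UNIV :: ('n \<times> bool) set))"
    by (metis card_inj_on_le)
  then have *: "card S * m \<le> card B * (2 * d)"
    by (simp add: card_cartesian_product d_def mult.commute)
  have "n * card S \<le> (d * m) * card S"
    using n_le by simp
  also have "\<dots> \<le> d * (card B * (2 * d))"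
    using mult_le_mono2 [OF *, of d] by (simp add: algebra_simps)
  finally show ?thesis
    by (simp add: S_def B_def sphere_card_def ball_card_def d_def power2_eq_square algebra_simps)
qed

section \<open>An isoperimetric inequality\<close>

definition outer_boundary :: "(int ^ 'n) set \<Rightarrow> (int ^ 'n) set" where
  "outer_boundary A = {y. y \<notin> A \<and> (\<exists>x\<in>A. adjacent x y)}"

lemma finite_neighbours: "finite {y :: int ^ 'n. adjacent x y}"
proof -
  have "{y. adjacent x y} \<subseteq> (\<lambda>z. x + z) ` {z. l1_norm z = 1}"
  proof
    fix y assume "y \<in> {y. adjacent x y}"
    then have "l1_norm (y - x) = 1" by (simp add: adjacent_def l1_norm_minus_commute)
    then show "y \<in> (\<lambda>z. x + z) ` {z. l1_norm z = 1}"
      by (intro image_eqI [of _ _ "y - x"]) auto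
  qed
  then show ?thesis
    by (rule finite_subset) (intro finite_imageI finite_l1_norm_eq)
qed

lemma finite_outer_boundary:
  assumes "finite A"
  shows "finite (outer_boundary A)"
proof -
  have "outer_boundary A \<subseteq> (\<Union>x\<in>A. {y. adjacent x y})"
    by (auto simp: outer_boundary_def)
  then show ?thesis
    by (rule finite_subset) (simp add: assms finite_neighbours)
qed

text \<open>
  The number of points of \<open>A\<close> that a translation moves out of \<open>A\<close> is subadditive in the
  translation vector, and a unit translation moves them injectively into the boundary.
\<close>

lemma card_translate_exits_le:
  fixes A :: "(int ^ 'n) set"
  assumes "finite A"
  shows "l1_norm z \<le> int r \<Longrightarrow> card {x \<in> A. x + z \<notin> A} \<le> r * card (outer_boundary A)"
proof (induction r arbitrary: z)
  case 0
  then have "z = 0"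
    using l1_norm_nonneg [of z] l1_norm_eq_0_iff [of z] by (simp del: l1_norm_eq_0_iff)
  then show ?case by simp
next
  case (Suc r)
  show ?case
  proof (cases "z = 0")
    case False
    then obtain i where i: "z $ i \<noteq> 0"
      by (auto simp: vec_eq_iff)
    define e :: "int ^ 'n" where "e = axis i (sgn (z $ i))"
    define w where "w = z - e"
    have "w = z + axis i (- sgn (z $ i))"
      by (simp add: w_def e_def vec_eq_iff axis_def)
    then have "l1_norm w = l1_norm z - 1"
      using i by (simp only: l1_norm_add_axis) (auto simp: sgn_if)
    then have w: "l1_norm w \<le> int r"
      using Suc.prems by simp
    have e: "l1_norm e = 1"
      using i by (simp add: e_def sgn_if)
    \<comment> \<open>A point that leaves \<open>A\<close> under \<open>z = w + e\<close> has left it after \<open>w\<close> or leaves it with the last step.\<close>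
    define X where "X = {x \<in> A. x + w \<notin> A}"
    define Y where "Y = {x \<in> A. x + w \<in> A \<and> x + w + e \<notin> A}"
    have "{x \<in> A. x + z \<notin> A} \<subseteq> X \<union> Y"
      by (auto simp: X_def Y_def w_def)
    moreover have fin: "finite X" "finite Y"
      using assms by (simp_all add: X_def Y_def)
    ultimately have "card {x \<in> A. x + z \<notin> A} \<le> card (X \<union> Y)"
      by (intro card_mono) auto
    also have "\<dots> \<le> card X + card Y"
      by (rule card_Un_le)
    also have "card X \<le> r * card (outer_boundary A)"
      unfolding X_def by (rule Suc.IH [OF w])
    also have "card Y \<le> card (outer_boundary A)"
    proof (rule card_inj_on_le [of "\<lambda>x. x + w + e"])
      have "adjacent (x + w) (x + w + e)" for x
        using l1_norm_minus_commute [of "x + w" "x + w + e"] by (simp add: adjacent_def e)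
      then show "(\<lambda>x. x + w + e) ` Y \<subseteq> outer_boundary A"
        by (auto simp: Y_def outer_boundary_def)
    qed (auto simp: inj_on_def finite_outer_boundary assms)
    finally show ?thesis by simp
  qed simp
qed

text \<open>
  The averaging argument of Coulhon and Saloff-Coste: at most \<open>card A\<close> of the translations in a
  ball \<open>G\<close> keep a given \<open>x \<in> A\<close> inside \<open>A\<close>, so if \<open>card G \<ge> 2 * card A\<close> then an average translation
  moves at least half of \<open>A\<close> out of \<open>A\<close>. By the previous lemma it moves out at most \<open>r\<close> times as
  many points as the boundary has.
\<close>

lemma card_le_radius_times_outer_boundary:
  fixes A :: "(int ^ 'n) set"
  assumes fin: "finite A" and large: "2 * card A \<le> ball_card TYPE('n) (Suc r)"
  shows "card A \<le> 2 * r * card (outer_boundary A)"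
proof (cases "A = {}")
  case False
  define G where "G = {z :: int ^ 'n. l1_norm z < int (Suc r)}"
  define E where "E = {(x, z) \<in> A \<times> G. x + z \<notin> A}"
  have finG: "finite G" unfolding G_def by (rule finite_l1_norm_less)
  have G: "2 * card A \<le> card G" using large by (simp add: G_def ball_card_def)
  have "card A * (card G - card A) \<le> (\<Sum>x\<in>A. card {z \<in> G. x + z \<notin> A})"
  proof -
    have "card G - card A \<le> card {z \<in> G. x + z \<notin> A}" for x
    proof -
      have "card {z \<in> G. x + z \<in> A} \<le> card A"
        by (rule card_inj_on_le [of "\<lambda>z. x + z"]) (auto simp: inj_on_def fin)
      moreover have "card G = card {z \<in> G. x + z \<in> A} + card {z \<in> G. x + z \<notin> A}"
        by (subst card_Un_disjoint [symmetric]) (auto simp: finG intro!: arg_cong [of _ _ card])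
      ultimately show ?thesis by linarith
    qed
    then show ?thesis
      using sum_bounded_below [of A "card G - card A"] by simp
  qed
  also have "\<dots> = (\<Sum>z\<in>G. card {x \<in> A. x + z \<notin> A})"
    using sum.swap_restrict [OF fin finG, of "\<lambda>_ _. 1::nat" "\<lambda>x z. x + z \<notin> A"] by simp
  also have "\<dots> \<le> (\<Sum>z\<in>G. r * card (outer_boundary A))"
    by (intro sum_mono card_translate_exits_le fin) (simp add: G_def)
  also have "\<dots> = card G * (r * card (outer_boundary A))"
    by simp
  finally have *: "card A * (card G - card A) \<le> card G * (r * card (outer_boundary A))" .
  have "card G * card A \<le> card A * (2 * (card G - card A))"
    unfolding mult.commute [of "card G"] using G by (intro mult_le_mono2) linarith
  also have "\<dots> \<le> card G * (2 * r * card (outer_boundary A))"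
    using * by (simp add: algebra_simps)
  finally have le: "card G * card A \<le> card G * (2 * r * card (outer_boundary A))" .
  moreover have "0 < card A" using False fin by (simp add: card_gt_0_iff)
  ultimately show ?thesis using G by simp
qed simp

text \<open>
  For \<open>card A\<close> comparable to a ball of radius \<open>n\<close>, translations of length \<open>O n\<close> suffice above, so
  the boundary has at least about \<open>card A / n\<close> points, which is at least of the order of the sphere.
\<close>

lemma sphere_card_le_outer_boundary:
  fixes A :: "(int ^ 'n) set"
  assumes fin: "finite A"
    and lower: "ball_card TYPE('n) n < card A" and upper: "card A \<le> ball_card TYPE('n) (Suc n)"
  shows "sphere_card TYPE('n) n \<le> 16 * CARD('n)\<^sup>2 * card (outer_boundary A)"
proof -
  let ?d = "CARD('n)" and ?s = "sphere_card TYPE('n) n" and ?b = "card (outer_boundary A)"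
  have "2 * card A \<le> ball_card TYPE('n) (Suc (3 * n + 1))"
    using upper ball_card_double [where 'n = 'n, of n] by simp
  then have A: "card A \<le> 2 * (3 * n + 1) * ?b"
    by (rule card_le_radius_times_outer_boundary [OF fin])
  show ?thesis
  proof (cases "n = 0")
    case True
    then have "0 < ?b" using A lower by (cases "?b = 0") auto
    then have "1 \<le> 16 * ?d\<^sup>2 * ?b"
      by (simp add: Suc_le_eq)
    then show ?thesis using True by simp
  next
    case False
    have "n * ?s \<le> 2 * ?d\<^sup>2 * ball_card TYPE('n) n"
      by (rule radius_times_sphere_card_le)
    also have "\<dots> \<le> 2 * ?d\<^sup>2 * (2 * (4 * n) * ?b)"
    proof (rule mult_le_mono2)
      have "2 * (3 * n + 1) * ?b \<le> 2 * (4 * n) * ?b"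
        using False by (intro mult_le_mono1) auto
      then show "ball_card TYPE('n) n \<le> 2 * (4 * n) * ?b"
        using A lower by linarith
    qed
    also have "\<dots> = n * (16 * ?d\<^sup>2 * ?b)"
      by (simp add: algebra_simps)
    finally show ?thesis using False by simp
  qed
qed

section \<open>The sequence of largest values\<close>

lemma infinite_lattice: "infinite (UNIV :: (int ^ 'n) set)"
proof
  assume "finite (UNIV :: (int ^ 'n) set)"
  then have "finite (range (axis i :: int \<Rightarrow> int ^ 'n))" for i
    by (rule finite_subset [rotated]) simp
  moreover have "inj (axis i :: int \<Rightarrow> int ^ 'n)" for i
    by (simp add: inj_def axis_eq_axis)
  ultimately show False
    using finite_imageD infinite_UNIV_int by blast
qed

text \<open>
  The greatest \<open>t\<close> in the definition of \<open>kth_largest\<close> exists: if some \<open>t > 0\<close> is admissible, then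
  all sets that witness a value \<open>\<ge> t\<close> are contained in the finite set \<open>{\<bar>f\<bar> > t / 2}\<close>, which leaves
  finitely many candidates; otherwise the maximum is \<open>0\<close>, as the lattice is infinite.
\<close>

lemma kth_largest_greatest:
  fixes f :: "int ^ 'n \<Rightarrow> real"
  assumes f: "vanishes_at_infinity f" and k: "1 \<le> k"
  shows kth_largest_attained: "\<exists>A. finite A \<and> card A = k \<and> (\<forall>x\<in>A. kth_largest f k \<le> \<bar>f x\<bar>)"
    and kth_largest_upper: "\<And>t A. finite A \<Longrightarrow> card A = k \<Longrightarrow> (\<And>x. x \<in> A \<Longrightarrow> t \<le> \<bar>f x\<bar>) \<Longrightarrow> t \<le> kth_largest f k"
proof -
  define P where "P t \<longleftrightarrow> 0 \<le> t \<and> (\<exists>A. finite A \<and> card A = k \<and> (\<forall>x\<in>A. t \<le> \<bar>f x\<bar>))" for t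
  have "\<exists>t. P t \<and> (\<forall>s. P s \<longrightarrow> s \<le> t)"
  proof (cases "\<exists>t>0. P t")
    case False
    have "\<exists>A :: (int ^ 'n) set. finite A \<and> card A = k"
      using infinite_arbitrarily_large [OF infinite_lattice] by blast
    then have "P 0" by (auto simp: P_def)
    then show ?thesis using False by (meson linorder_not_le)
  next
    case True
    then obtain t A where t: "0 < t" and A: "finite A" "card A = k" "\<forall>x\<in>A. t \<le> \<bar>f x\<bar>"
      by (auto simp: P_def)
    define F where "F = {x. t / 2 < \<bar>f x\<bar>}"
    have "finite F"
      using f t unfolding F_def vanishes_at_infinity_def by (meson half_gt_zero)
    define \<A> where "\<A> = {A. A \<subseteq> F \<and> card A = k}"
    have fin: "finite \<A>"
      using \<open>finite F\<close> by (simp add: \<A>_def)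
    have finA: "finite B \<and> B \<noteq> {}" if "B \<in> \<A>" for B
    proof
      have "0 < card B" using that k by (simp add: \<A>_def)
      then show "finite B" "B \<noteq> {}" by (simp_all add: card_gt_0_iff)
    qed
    define low where "low B = Min ((\<lambda>x. \<bar>f x\<bar>) ` B)" for B
    define s where "s = Max (low ` \<A>)"
    have above: "r \<le> s" if "finite B" "card B = k" "\<forall>x\<in>B. r \<le> \<bar>f x\<bar>" "t \<le> r" for r B
    proof -
      have "B \<in> \<A>"
        using that t by (fastforce simp: \<A>_def F_def)
      then have "r \<le> low B"
        using finA that by (simp add: low_def)
      also have "\<dots> \<le> s"
        unfolding s_def using \<open>B \<in> \<A>\<close> fin by simp
      finally show ?thesis .
    qed
    then have "t \<le> s" using A by blast
    have "A \<in> \<A>"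
      using A t by (fastforce simp: \<A>_def F_def)
    then have "s \<in> low ` \<A>"
      unfolding s_def using fin by (intro Max_in) auto
    then obtain B where B: "B \<in> \<A>" "s = low B" by blast
    then have "\<forall>x\<in>B. s \<le> \<bar>f x\<bar>"
      using finA by (simp add: low_def)
    moreover have "finite B" "card B = k"
      using finA [OF B(1)] B(1) by (simp_all add: \<A>_def)
    ultimately have "P s"
      using t \<open>t \<le> s\<close> by (auto simp: P_def intro!: exI [of _ B])
    moreover have "r \<le> s" if "P r" for r
    proof (cases "t \<le> r")
      case True
      then show ?thesis using that above unfolding P_def by blast
    qed (use \<open>t \<le> s\<close> in linarith)
    ultimately show ?thesis by blast
  qed
  then obtain t where t: "P t" "\<And>s. P s \<Longrightarrow> s \<le> t" by blast
  then have kth: "kth_largest f k = t"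
    unfolding kth_largest_def P_def by (intro Greatest_equality) auto
  show "\<exists>A. finite A \<and> card A = k \<and> (\<forall>x\<in>A. kth_largest f k \<le> \<bar>f x\<bar>)"
    using t(1) by (auto simp: kth P_def)
  fix r A
  assume A: "finite A" "card A = k" "\<And>x. x \<in> A \<Longrightarrow> r \<le> \<bar>f x\<bar>"
  then have "P (max 0 r)" by (auto simp: P_def)
  then show "r \<le> kth_largest f k"
    using t(2) kth by fastforce
qed

lemma kth_largest_antimono:
  assumes f: "vanishes_at_infinity f" and "1 \<le> k" "k \<le> l"
  shows "kth_largest f l \<le> kth_largest f k"
proof -
  obtain A where A: "finite A" "card A = l" "\<forall>x\<in>A. kth_largest f l \<le> \<bar>f x\<bar>"
    using kth_largest_attained [OF f, of l] assms by auto
  then obtain B where "B \<subseteq> A" "card B = k" "finite B"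
    using obtain_subset_with_card_n [of k A] \<open>k \<le> l\<close> by metis
  then show ?thesis
    using A assms by (intro kth_largest_upper) auto
qed

lemma card_above_kth_largest_less:
  assumes f: "vanishes_at_infinity f" and k: "1 \<le> k"
    and Y: "finite Y" "\<And>y. y \<in> Y \<Longrightarrow> kth_largest f k < \<bar>f y\<bar>"
  shows "card Y < k"
proof (rule ccontr)
  assume "\<not> card Y < k"
  then obtain B where B: "B \<subseteq> Y" "card B = k" "finite B"
    using obtain_subset_with_card_n [of k Y] by (metis linorder_not_less)
  then have ne: "B \<noteq> {}" using k by auto
  have "Min ((\<lambda>x. \<bar>f x\<bar>) ` B) \<le> kth_largest f k"
    using B f k by (intro kth_largest_upper) auto
  moreover have "kth_largest f k < Min ((\<lambda>x. \<bar>f x\<bar>) ` B)"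
    using B ne Y by auto
  ultimately show False by simp
qed

section \<open>Edges across gaps of values\<close>

definition crosses :: "(int ^ 'n \<Rightarrow> real) \<Rightarrow> real \<Rightarrow> real \<Rightarrow> (int ^ 'n) set \<Rightarrow> bool" where
  "crosses f s t e \<longleftrightarrow> (\<exists>x y. e = {x, y} \<and> s \<le> \<bar>f x\<bar> \<and> \<bar>f y\<bar> \<le> t)"

text \<open>
  Take \<open>i\<close> points with values at least the \<open>i\<close>-th largest one, hence above the \<open>j\<close>-th largest one.
  Together with them, the boundary points above the \<open>j\<close>-th largest value number fewer than
  \<open>j \<le> i + m\<close>, so at most \<open>m - 1\<close> of the at least \<open>2 m - 1\<close> boundary points are that high. Each
  of the others gives its own edge.
\<close>

lemma many_crossing_edges:
  fixes f :: "int ^ 'n \<Rightarrow> real"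
  assumes f: "vanishes_at_infinity f" and ij: "1 \<le> i" "i \<le> j" "j \<le> i + m"
    and drop: "kth_largest f j < kth_largest f i"
    and iso: "\<And>A :: (int ^ 'n) set. finite A \<Longrightarrow> card A = i \<Longrightarrow> 2 * m \<le> card (outer_boundary A) + 1"
  obtains W where "finite W" "W \<subseteq> edges" "m \<le> card W"
    and "\<And>e. e \<in> W \<Longrightarrow> crosses f (kth_largest f i) (kth_largest f j) e"
proof -
  let ?a = "kth_largest f"
  obtain A where A: "finite A" "card A = i" "\<forall>x\<in>A. ?a i \<le> \<bar>f x\<bar>"
    using kth_largest_attained [OF f ij(1)] by auto
  let ?b = "outer_boundary A"
  have finb: "finite ?b"
    by (rule finite_outer_boundary [OF A(1)])
  define hi where "hi = {y \<in> ?b. ?a j < \<bar>f y\<bar>}"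
  define lo where "lo = {y \<in> ?b. \<bar>f y\<bar> \<le> ?a j}"
  have fin: "finite hi" "finite lo"
    using finb by (simp_all add: hi_def lo_def)
  have "card (A \<union> hi) < j"
    using A drop fin ij by (intro card_above_kth_largest_less [OF f]) (auto simp: hi_def)
  moreover have "card (A \<union> hi) = i + card hi"
    using A fin by (subst card_Un_disjoint) (auto simp: hi_def outer_boundary_def)
  ultimately have "card hi < m" using ij by simp
  moreover have "card ?b = card hi + card lo"
    using fin by (subst card_Un_disjoint [symmetric]) (auto simp: hi_def lo_def intro!: arg_cong [of _ _ card])
  ultimately have m: "m \<le> card lo"
    using iso [OF A(1,2)] by linarith
  have "\<forall>y\<in>lo. \<exists>x. x \<in> A \<and> adjacent x y"
    by (auto simp: lo_def outer_boundary_def)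
  then obtain g where g: "\<And>y. y \<in> lo \<Longrightarrow> g y \<in> A \<and> adjacent (g y) y"
    by metis
  define W where "W = (\<lambda>y. {g y, y}) ` lo"
  have "lo \<inter> A = {}"
    by (auto simp: lo_def outer_boundary_def)
  then have "inj_on (\<lambda>y. {g y, y}) lo"
    using g by (auto simp: inj_on_def doubleton_eq_iff)
  then have "card W = card lo"
    by (simp add: W_def card_image)
  then show ?thesis
    using g A fin m by (intro that [of W]) (auto simp: W_def edges_def crosses_def lo_def)
qed

section \<open>Disjoint gaps are paid for by the gradient\<close>

lemma sum_powr_le_powr_sum:
  fixes x :: "'a \<Rightarrow> real"
  assumes "\<And>i. i \<in> I \<Longrightarrow> 0 \<le> x i" and p: "1 \<le> p"
  shows "(\<Sum>i\<in>I. x i powr p) \<le> (\<Sum>i\<in>I. x i) powr p"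
proof (cases "finite I")
  case True
  let ?X = "\<Sum>i\<in>I. x i"
  have split: "t powr p = t * t powr (p - 1)" if "0 \<le> t" for t :: real
    using powr_mult_base [OF that, of "p - 1"] by simp
  have "(\<Sum>i\<in>I. x i powr p) \<le> (\<Sum>i\<in>I. x i * ?X powr (p - 1))"
  proof (rule sum_mono)
    fix i assume i: "i \<in> I"
    then have "x i \<le> ?X"
      using True assms by (intro member_le_sum) auto
    then show "x i powr p \<le> x i * ?X powr (p - 1)"
      using i assms p by (subst split) (auto intro!: mult_left_mono powr_mono2)
  qed
  also have "\<dots> = ?X powr p"
    using assms by (subst split [of ?X]) (auto simp: sum_distrib_right intro!: sum_nonneg)
  finally show ?thesis .
qed simp

lemma powr_sum_le:
  fixes x :: "'a \<Rightarrow> real"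
  assumes fin: "finite I" and nonneg: "\<And>i. i \<in> I \<Longrightarrow> 0 \<le> x i" and p: "0 \<le> p"
  shows "(\<Sum>i\<in>I. x i) powr p \<le> real (card I) powr p * (\<Sum>i\<in>I. x i powr p)"
proof (cases "I = {}")
  case False
  define M where "M = Max (x ` I)"
  have le: "x i \<le> M" if "i \<in> I" for i
    using that fin by (simp add: M_def)
  have "M \<in> x ` I"
    unfolding M_def using fin False by (intro Max_in) auto
  then obtain i where i: "i \<in> I" "x i = M" by blast
  have M: "0 \<le> M" using i nonneg by metis
  have "(\<Sum>i\<in>I. x i) \<le> real (card I) * M"
    by (rule sum_bounded_above [OF le])
  then have "(\<Sum>i\<in>I. x i) powr p \<le> (real (card I) * M) powr p"
    using nonneg p by (intro powr_mono2 sum_nonneg) auto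
  also have "\<dots> = real (card I) powr p * x i powr p"
    using M i by (simp add: powr_mult)
  also have "\<dots> \<le> real (card I) powr p * (\<Sum>i\<in>I. x i powr p)"
    using i fin by (intro mult_left_mono member_le_sum) auto
  finally show ?thesis .
qed simp

text \<open>
  The thresholds \<open>T n 0, \<dots>, T n K = T (n + 1) 0, \<dots>\<close> form one decreasing sequence, indexed by level
  and by step inside the level. For a fixed edge the gaps that it crosses are disjoint
  subintervals of the interval between its two values, so their lengths add up to at most
  \<open>edge_diff\<close>, and superadditivity of the \<open>p\<close>-th power gives the same for the \<open>p\<close>-th powers.
\<close>

lemma sum_crossings_le:
  fixes f :: "int ^ 'n \<Rightarrow> real" and T :: "nat \<Rightarrow> nat \<Rightarrow> real"
  assumes p: "1 \<le> p"
    and T: "\<And>n k. T n (Suc k) \<le> T n k" "\<And>n. T n K = T (Suc n) 0"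
    and W: "\<And>n k. finite (W n k)" "\<And>n k e. e \<in> W n k \<Longrightarrow> crosses f (T n k) (T n (Suc k)) e"
  shows "(\<Sum>n<N. \<Sum>k<K. real (card (W n k)) * (T n k - T n (Suc k)) powr p)
    \<le> (\<Sum>e\<in>(\<Union>n<N. \<Union>k<K. W n k). edge_diff (\<lambda>x. \<bar>f x\<bar>) e powr p)"
proof -
  define I where "I = {..<N} \<times> {..<K}"
  define V where "V q = W (fst q) (snd q)" for q
  define D where "D q = T (fst q) (snd q) - T (fst q) (Suc (snd q))" for q
  define U where "U = (\<Union>n<N. \<Union>k<K. W n k)"
  have fin: "finite I" "finite U"
    using W by (auto simp: I_def U_def)
  have D: "0 \<le> D q" for q
    using T by (simp add: D_def)
  have diff: "(\<Sum>q | q \<in> I \<and> e \<in> V q. D q) \<le> edge_diff (\<lambda>x. \<bar>f x\<bar>) e" if "e \<in> U" for e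
  proof -
    define u where "u = Max ((\<lambda>x. \<bar>f x\<bar>) ` e)"
    define l where "l = Min ((\<lambda>x. \<bar>f x\<bar>) ` e)"
    \<comment> \<open>Clamping to the range of the edge keeps the crossed gaps and makes all gaps telescope to at most \<open>u - l\<close>.\<close>
    define c where "c t = max l (min u t)" for t
    from that obtain n k where "e \<in> W n k"
      unfolding U_def by blast
    then obtain x y where e: "e = {x, y}"
      using W(2) unfolding crosses_def by blast
    have lu: "l \<le> u"
      unfolding l_def u_def e by simp
    have c: "c s \<le> c t" if "s \<le> t" for s t
      using that by (auto simp: c_def)
    have "(\<Sum>q | q \<in> I \<and> e \<in> V q. D q)
        = (\<Sum>q | q \<in> I \<and> e \<in> V q. c (T (fst q) (snd q)) - c (T (fst q) (Suc (snd q))))"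
    proof (rule sum.cong)
      fix q assume "q \<in> {q \<in> I. e \<in> V q}"
      then have "crosses f (T (fst q) (snd q)) (T (fst q) (Suc (snd q))) e"
        using W by (simp add: V_def)
      then obtain x y where xy: "e = {x, y}" "T (fst q) (snd q) \<le> \<bar>f x\<bar>" "\<bar>f y\<bar> \<le> T (fst q) (Suc (snd q))"
        by (auto simp: crosses_def)
      have "T (fst q) (snd q) \<le> u"
        using xy unfolding u_def by (auto simp: le_max_iff_disj)
      moreover have "l \<le> T (fst q) (Suc (snd q))"
        using xy unfolding l_def by (auto simp: min_le_iff_disj)
      ultimately show "D q = c (T (fst q) (snd q)) - c (T (fst q) (Suc (snd q)))"
        using T(1) [of "fst q" "snd q"] by (simp add: D_def c_def)
    qed simp
    also have "\<dots> \<le> (\<Sum>q\<in>I. c (T (fst q) (snd q)) - c (T (fst q) (Suc (snd q))))"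
      using fin T by (intro sum_mono2) (auto intro!: c)
    also have "\<dots> = (\<Sum>n<N. \<Sum>k<K. c (T n k) - c (T n (Suc k)))"
      unfolding I_def sum.cartesian_product by (simp add: case_prod_beta)
    also have "\<dots> = (\<Sum>n<N. c (T n 0) - c (T (Suc n) 0))"
    proof (rule sum.cong)
      fix n
      show "(\<Sum>k<K. c (T n k) - c (T n (Suc k))) = c (T n 0) - c (T (Suc n) 0)"
        using sum_lessThan_telescope' [of "\<lambda>k. c (T n k)" K] by (simp only: T(2))
    qed simp
    also have "\<dots> = c (T 0 0) - c (T N 0)"
      by (rule sum_lessThan_telescope')
    also have "\<dots> \<le> u - l"
      using lu by (auto simp: c_def)
    finally show ?thesis
      by (simp add: edge_diff_def u_def l_def)
  qed
  have "(\<Sum>n<N. \<Sum>k<K. real (card (W n k)) * (T n k - T n (Suc k)) powr p)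
      = (\<Sum>q\<in>I. real (card (V q)) * D q powr p)"
    unfolding I_def sum.cartesian_product by (simp add: V_def D_def case_prod_beta)
  also have "\<dots> = (\<Sum>q\<in>I. \<Sum>e | e \<in> U \<and> e \<in> V q. D q powr p)"
  proof (rule sum.cong)
    fix q assume "q \<in> I"
    then have "V q \<subseteq> U"
      unfolding U_def V_def I_def by fastforce
    then have "{e. e \<in> U \<and> e \<in> V q} = V q"
      by blast
    then show "real (card (V q)) * D q powr p = (\<Sum>e | e \<in> U \<and> e \<in> V q. D q powr p)"
      by simp
  qed simp
  also have "\<dots> = (\<Sum>e\<in>U. \<Sum>q | q \<in> I \<and> e \<in> V q. D q powr p)"
    by (rule sum.swap_restrict [OF fin])
  also have "\<dots> \<le> (\<Sum>e\<in>U. (\<Sum>q | q \<in> I \<and> e \<in> V q. D q) powr p)"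
    using D p by (intro sum_mono sum_powr_le_powr_sum) auto
  also have "\<dots> \<le> (\<Sum>e\<in>U. edge_diff (\<lambda>x. \<bar>f x\<bar>) e powr p)"
    using diff D p by (intro sum_mono powr_mono2 sum_nonneg) auto
  finally show ?thesis
    by (simp add: U_def)
qed

section \<open>Splitting the drop across a sphere into crossable steps\<close>

text \<open>
  The indices of level \<open>n\<close> are divided into steps of length \<open>m n = \<lceil>\<sigma> n / K\<rceil>\<close>, truncated at the end
  of the level. As \<open>K\<close> is twice the isoperimetric constant, the boundary of a set of the
  size in question has at least \<open>2 m n - 1\<close> points, as needed for crossing edges; and \<open>K\<close> steps
  exhaust the level.
\<close>

lemma level_refinement:
  fixes f :: "int ^ 'n \<Rightarrow> real"
  assumes f: "vanishes_at_infinity f"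
  defines "K \<equiv> 32 * CARD('n)\<^sup>2"
  obtains T :: "nat \<Rightarrow> nat \<Rightarrow> real" and W :: "nat \<Rightarrow> nat \<Rightarrow> (int ^ 'n) set set"
  where "\<And>n. T n 0 = kth_largest f (Suc (ball_card TYPE('n) n))"
    and "\<And>n. T n K = kth_largest f (Suc (ball_card TYPE('n) (Suc n)))"
    and "\<And>n k. T n (Suc k) \<le> T n k"
    and "\<And>n k. finite (W n k) \<and> W n k \<subseteq> edges"
    and "\<And>n k e. e \<in> W n k \<Longrightarrow> crosses f (T n k) (T n (Suc k)) e"
    and "\<And>n k. T n (Suc k) < T n k \<Longrightarrow> sphere_card TYPE('n) n \<le> K * card (W n k)"
proof -
  let ?a = "kth_largest f" and ?\<beta> = "ball_card TYPE('n)" and ?\<sigma> = "sphere_card TYPE('n)"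
  have K: "0 < K" by (simp add: K_def)
  define m where "m n = (?\<sigma> n + K - 1) div K" for n
  have m_ge: "?\<sigma> n \<le> K * m n" for n
    unfolding m_def using K dividend_less_times_div [of K "?\<sigma> n + K - 1"]
    by linarith
  have m_less: "K * m n < ?\<sigma> n + K" for n
    unfolding m_def using K times_div_less_eq_dividend [of K "?\<sigma> n + K - 1"]
    by linarith
  define \<iota> where "\<iota> n k = min (Suc (?\<beta> n + k * m n)) (Suc (?\<beta> (Suc n)))" for n k
  define T where "T n k = ?a (\<iota> n k)" for n k
  have \<iota>: "1 \<le> \<iota> n k" "\<iota> n k \<le> \<iota> n (Suc k)" "\<iota> n (Suc k) \<le> \<iota> n k + m n" for n k
    by (auto simp: \<iota>_def)
  have \<iota>_0: "\<iota> n 0 = Suc (?\<beta> n)" for n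
    by (simp add: \<iota>_def ball_card_Suc)
  have \<iota>_K: "\<iota> n K = Suc (?\<beta> (Suc n))" for n
    using m_ge [of n] by (simp add: \<iota>_def ball_card_Suc)
  have "\<exists>W. finite W \<and> W \<subseteq> edges \<and> (\<forall>e\<in>W. crosses f (T n k) (T n (Suc k)) e)
      \<and> (T n (Suc k) < T n k \<longrightarrow> ?\<sigma> n \<le> K * card W)" for n k
  proof (cases "T n (Suc k) < T n k")
    case True
    then have "\<iota> n k \<noteq> \<iota> n (Suc k)" by (auto simp: T_def)
    \<comment> \<open>A proper step starts inside the level, before the truncation, where isoperimetry applies.\<close>
    then have range: "?\<beta> n < \<iota> n k" "\<iota> n k \<le> ?\<beta> (Suc n)"
      by (auto simp: \<iota>_def min_def split: if_splits)
    have "2 * m n \<le> card (outer_boundary A) + 1"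
      if "finite A" "card A = \<iota> n k" for A :: "(int ^ 'n) set"
    proof -
      let ?c = "16 * CARD('n)\<^sup>2" and ?b = "card (outer_boundary A)"
      have "?\<sigma> n \<le> ?c * ?b"
        using that range by (intro sphere_card_le_outer_boundary) simp_all
      moreover have "?c * (2 * m n) < ?\<sigma> n + ?c * 2"
        using m_less [of n] by (simp add: K_def)
      ultimately have "?c * (2 * m n) < ?c * (?b + 2)"
        by (simp add: algebra_simps)
      then show ?thesis
        unfolding mult_less_cancel1 by linarith
    qed
    then obtain W where W: "finite W" "W \<subseteq> edges" "m n \<le> card W"
      "\<And>e. e \<in> W \<Longrightarrow> crosses f (?a (\<iota> n k)) (?a (\<iota> n (Suc k))) e"
      using many_crossing_edges [OF f \<iota> [of n k]] True unfolding T_def by metis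
    have "?\<sigma> n \<le> K * card W"
      using m_ge [of n] mult_le_mono2 [OF W(3), of K] by linarith
    then show ?thesis
      using W by (auto simp: T_def)
  next
    case False
    then show ?thesis by (intro exI [of _ "{}"]) simp
  qed
  then obtain W where W: "\<And>n k. finite (W n k) \<and> W n k \<subseteq> edges \<and>
      (\<forall>e\<in>W n k. crosses f (T n k) (T n (Suc k)) e) \<and> (T n (Suc k) < T n k \<longrightarrow> ?\<sigma> n \<le> K * card (W n k))"
    by metis
  show ?thesis
  proof (rule that [of T W])
    show "T n 0 = ?a (Suc (?\<beta> n))" "T n K = ?a (Suc (?\<beta> (Suc n)))" for n
      by (simp_all add: T_def \<iota>_0 \<iota>_K)
    show "T n (Suc k) \<le> T n k" for n k
      unfolding T_def by (rule kth_largest_antimono [OF f \<iota>(1,2)])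
  qed (use W in auto)
qed

definition level_drop :: "(int ^ 'n \<Rightarrow> real) \<Rightarrow> nat \<Rightarrow> real" where
  "level_drop f n =
    kth_largest f (Suc (ball_card TYPE('n) n)) - kth_largest f (Suc (ball_card TYPE('n) (Suc n)))"

lemma level_drop_nonneg:
  "vanishes_at_infinity f \<Longrightarrow> 0 \<le> level_drop f n"
  unfolding level_drop_def by (simp add: kth_largest_antimono ball_card_Suc)

lemma edge_diff_nonneg:
  assumes "e \<in> edges"
  shows "0 \<le> edge_diff f e"
  using assms by (auto simp: edges_def edge_diff_doubleton)

lemma edge_diff_abs_le:
  assumes "e \<in> edges"
  shows "edge_diff (\<lambda>x. \<bar>f x\<bar>) e \<le> edge_diff f e"
  using assms abs_triangle_ineq3 by (auto simp: edges_def edge_diff_doubleton)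

text \<open>
  The case \<open>p = \<infinity>\<close>: every proper step is crossed by at least one edge, so none of the \<open>K\<close> steps
  exceeds the supremum of the gradient.
\<close>

lemma level_drop_le_sup:
  fixes f :: "int ^ 'n \<Rightarrow> real"
  assumes f: "vanishes_at_infinity f" and M: "\<And>e. e \<in> edges \<Longrightarrow> edge_diff f e \<le> M" "0 \<le> M"
  shows "level_drop f n \<le> 32 * (real CARD('n))\<^sup>2 * M"
proof -
  let ?K = "32 * CARD('n)\<^sup>2"
  obtain T W where T: "\<And>n. T n 0 = kth_largest f (Suc (ball_card TYPE('n) n))"
      "\<And>n. T n ?K = kth_largest f (Suc (ball_card TYPE('n) (Suc n)))"
    and W: "\<And>n k. finite (W n k) \<and> W n k \<subseteq> edges"
      "\<And>n k e. e \<in> W n k \<Longrightarrow> crosses f (T n k) (T n (Suc k)) e"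
      "\<And>n k. T n (Suc k) < T n k \<Longrightarrow> sphere_card TYPE('n) n \<le> ?K * card (W n k)"
    using level_refinement [OF f] by metis
  have step: "T n k - T n (Suc k) \<le> M" for k
  proof (cases "T n (Suc k) < T n k")
    case True
    have "card (W n k) \<noteq> 0"
      using W(3) [OF True] sphere_card_pos [where 'n = 'n, of n] by (metis mult_0_right not_less)
    then obtain e where e: "e \<in> W n k" by fastforce
    then obtain x y where xy: "e = {x, y}" "T n k \<le> \<bar>f x\<bar>" "\<bar>f y\<bar> \<le> T n (Suc k)"
      using W(2) unfolding crosses_def by blast
    have "\<bar>f x - f y\<bar> \<le> M"
      using M(1) [of e] W(1) e by (auto simp: xy edge_diff_doubleton)
    then show ?thesis using xy by linarith
  qed (use M in linarith)
  have "level_drop f n = (\<Sum>k<?K. T n k - T n (Suc k))"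
    unfolding sum_lessThan_telescope' T level_drop_def ..
  also have "\<dots> \<le> real (card {..<?K}) * M"
    by (rule sum_bounded_above [OF step])
  finally show ?thesis by simp
qed

text \<open>
  The case \<open>p < \<infinity>\<close>: splitting a drop into \<open>K\<close> steps costs a factor \<open>K powr p\<close>, and replacing the
  weight \<open>sphere_card n\<close> by the number of crossing edges costs a factor \<open>K\<close>.
\<close>

lemma sum_level_drop_le:
  fixes f :: "int ^ 'n \<Rightarrow> real"
  assumes f: "vanishes_at_infinity f" and p: "1 \<le> p"
  defines "K \<equiv> 32 * (real CARD('n))\<^sup>2"
  obtains U where "finite U" "U \<subseteq> edges"
    "(\<Sum>n<N. real (sphere_card TYPE('n) n) * level_drop f n powr p)
      \<le> K * K powr p * (\<Sum>e\<in>U. edge_diff f e powr p)"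
proof -
  let ?K = "32 * CARD('n)\<^sup>2" and ?\<sigma> = "sphere_card TYPE('n)"
  obtain T W where T: "\<And>n. T n 0 = kth_largest f (Suc (ball_card TYPE('n) n))"
      "\<And>n. T n ?K = kth_largest f (Suc (ball_card TYPE('n) (Suc n)))"
    and dec: "\<And>n k. T n (Suc k) \<le> T n k"
    and W: "\<And>n k. finite (W n k) \<and> W n k \<subseteq> edges"
      "\<And>n k e. e \<in> W n k \<Longrightarrow> crosses f (T n k) (T n (Suc k)) e"
      "\<And>n k. T n (Suc k) < T n k \<Longrightarrow> ?\<sigma> n \<le> ?K * card (W n k)"
    using level_refinement [OF f] by metis
  define D where "D n k = T n k - T n (Suc k)" for n k
  define U where "U = (\<Union>n<N. \<Union>k<?K. W n k)"
  have U: "finite U" "U \<subseteq> edges"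
    using W(1) by (auto simp: U_def)
  have K: "K = real ?K" by (simp add: K_def)
  have "real (?\<sigma> n) * level_drop f n powr p
      \<le> K * K powr p * (\<Sum>k<?K. real (card (W n k)) * D n k powr p)" for n
  proof -
    have weight: "real (?\<sigma> n) * D n k powr p \<le> K * (real (card (W n k)) * D n k powr p)" for k
    proof (cases "T n (Suc k) < T n k")
      case True
      have "real (?\<sigma> n) \<le> K * real (card (W n k))"
        using W(3) [OF True] unfolding K of_nat_mult [symmetric] of_nat_le_iff .
      then have "real (?\<sigma> n) * D n k powr p \<le> K * real (card (W n k)) * D n k powr p"
        by (rule mult_right_mono) simp
      then show ?thesis by (simp add: mult.assoc)
    next
      case False
      then have "D n k = 0" using dec [of n k] by (simp add: D_def)
      then show ?thesis by simp
    qed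
    have "level_drop f n = (\<Sum>k<?K. D n k)"
      unfolding D_def sum_lessThan_telescope' T level_drop_def ..
    then have "level_drop f n powr p \<le> real (card {..<?K}) powr p * (\<Sum>k<?K. D n k powr p)"
      using dec p by (simp only:) (intro powr_sum_le, auto simp: D_def)
    then have "real (?\<sigma> n) * level_drop f n powr p \<le> real (?\<sigma> n) * (K powr p * (\<Sum>k<?K. D n k powr p))"
      unfolding K card_lessThan by (rule mult_left_mono) simp
    also have "\<dots> = K powr p * (\<Sum>k<?K. real (?\<sigma> n) * D n k powr p)"
      by (simp add: sum_distrib_left mult_ac)
    also have "\<dots> \<le> K powr p * (\<Sum>k<?K. K * (real (card (W n k)) * D n k powr p))"
      using weight by (intro mult_left_mono sum_mono) auto
    also have "\<dots> = K * K powr p * (\<Sum>k<?K. real (card (W n k)) * D n k powr p)"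
      by (simp add: sum_distrib_left mult_ac)
    finally show ?thesis .
  qed
  then have "(\<Sum>n<N. real (?\<sigma> n) * level_drop f n powr p)
      \<le> (\<Sum>n<N. K * K powr p * (\<Sum>k<?K. real (card (W n k)) * D n k powr p))"
    by (rule sum_mono)
  also have "\<dots> = K * K powr p * (\<Sum>n<N. \<Sum>k<?K. real (card (W n k)) * D n k powr p)"
    by (rule sum_distrib_left [symmetric])
  also have "\<dots> \<le> K * K powr p * (\<Sum>e\<in>U. edge_diff (\<lambda>x. \<bar>f x\<bar>) e powr p)"
    unfolding D_def U_def using dec W T
    by (intro mult_left_mono sum_crossings_le [OF p]) (auto simp: K_def)
  also have "\<dots> \<le> K * K powr p * (\<Sum>e\<in>U. edge_diff f e powr p)"
    using U(2) p
    by (intro mult_left_mono sum_mono powr_mono2 edge_diff_abs_le edge_diff_nonneg) (auto simp: K_def)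
  finally show ?thesis
    using U that by blast
qed

section \<open>The gradient of the rearrangement\<close>

lemma index_bounds:
  fixes v :: "nat \<Rightarrow> int ^ 'n"
  assumes v: "enumeration_respecting_l1 v" and x: "l1_norm x = int n"
  shows "ball_card TYPE('n) n < inv_into {1..} v x"
    and "inv_into {1..} v x \<le> ball_card TYPE('n) (Suc n)"
proof -
  define idx where "idx = inv_into {1..} v"
  have bij: "bij_betw v {1..} UNIV"
    and ord: "\<And>i j. 1 \<le> i \<Longrightarrow> 1 \<le> j \<Longrightarrow> l1_norm (v i) < l1_norm (v j) \<Longrightarrow> i < j"
    using v by (auto simp: enumeration_respecting_l1_def)
  have v_idx: "v (idx y) = y" and idx_ge: "1 \<le> idx y" for y
    using bij_betw_imp_surj_on [OF bij] f_inv_into_f [of y v "{1..}"] inv_into_into [of y v "{1..}"]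
    by (auto simp: idx_def)
  have "ball_card TYPE('n) n \<le> card {1..<idx x}"
    unfolding ball_card_def
  proof (rule card_inj_on_le [of idx])
    show "inj_on idx {x. l1_norm x < int n}"
      by (metis inj_onI v_idx)
    show "idx ` {x. l1_norm x < int n} \<subseteq> {1..<idx x}"
      using ord [of "idx _" "idx x"] idx_ge by (auto simp: v_idx x)
  qed simp
  then show "ball_card TYPE('n) n < inv_into {1..} v x"
    using idx_ge [of x] by (simp add: idx_def)
  have "card {1..idx x} \<le> ball_card TYPE('n) (Suc n)"
    unfolding ball_card_def
  proof (rule card_inj_on_le [of v])
    show "inj_on v {1..idx x}"
      using bij by (auto simp: bij_betw_def inj_on_def)
    show "v ` {1..idx x} \<subseteq> {x. l1_norm x < int (Suc n)}"
      using ord [OF idx_ge [of x]] by (force simp: v_idx x)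
  qed (rule finite_l1_norm_less)
  then show "inv_into {1..} v x \<le> ball_card TYPE('n) (Suc n)"
    by (simp add: idx_def)
qed

lemma rearrangement_bounds:
  fixes v :: "nat \<Rightarrow> int ^ 'n"
  assumes v: "enumeration_respecting_l1 v" and f: "vanishes_at_infinity f"
    and x: "int n \<le> l1_norm x" "l1_norm x \<le> int (Suc n)"
  shows "rearrangement v f x \<le> kth_largest f (Suc (ball_card TYPE('n) n))"
    and "kth_largest f (Suc (ball_card TYPE('n) (Suc (Suc n)))) \<le> rearrangement v f x"
proof -
  consider "l1_norm x = int n" | "l1_norm x = int (Suc n)"
    using x by linarith
  then have "ball_card TYPE('n) n < inv_into {1..} v x \<and> inv_into {1..} v x \<le> ball_card TYPE('n) (Suc (Suc n))"
    by cases (use index_bounds [OF v] in \<open>fastforce simp: ball_card_Suc\<close>)+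
  then show "rearrangement v f x \<le> kth_largest f (Suc (ball_card TYPE('n) n))"
    and "kth_largest f (Suc (ball_card TYPE('n) (Suc (Suc n)))) \<le> rearrangement v f x"
    unfolding rearrangement_def by (auto intro!: kth_largest_antimono [OF f])
qed

lemma edge_oriented:
  fixes e :: "(int ^ 'n) set"
  assumes "e \<in> edges"
  obtains x y where "e = {x, y}" "adjacent x y" "l1_norm x \<le> l1_norm y"
proof -
  obtain x y where xy: "e = {x, y}" "adjacent x y"
    using assms by (auto simp: edges_def)
  then have "e = {y, x}" "adjacent y x"
    by (auto simp: adjacent_def l1_norm_minus_commute)
  then show ?thesis
    using xy that by (cases "l1_norm x \<le> l1_norm y") auto
qed

text \<open>Both endpoints lie in the spheres \<open>n\<close> and \<open>n + 1\<close>, whose values span the two drops.\<close>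

lemma edge_diff_rearrangement_le:
  fixes v :: "nat \<Rightarrow> int ^ 'n"
  assumes v: "enumeration_respecting_l1 v" and f: "vanishes_at_infinity f"
    and adj: "adjacent x y" and x: "l1_norm x = int n" "l1_norm x \<le> l1_norm y"
  shows "edge_diff (rearrangement v f) {x, y} \<le> level_drop f n + level_drop f (Suc n)"
proof -
  have "l1_norm y \<le> l1_norm x + l1_norm (y - x)"
    using l1_norm_triangle [of x "y - x"] by simp
  then have "l1_norm y \<le> int (Suc n)"
    using adj x by (simp add: adjacent_def l1_norm_minus_commute)
  then have y: "int n \<le> l1_norm y" "l1_norm y \<le> int (Suc n)"
    using x by simp_all
  have x': "int n \<le> l1_norm x" "l1_norm x \<le> int (Suc n)"
    using x by simp_all
  show ?thesis
    using rearrangement_bounds [OF v f x'] rearrangement_bounds [OF v f y]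
    unfolding edge_diff_doubleton level_drop_def by linarith
qed

text \<open>
  Edges are grouped by the norm of their endpoint closer to the origin. An edge is determined by
  this endpoint and a unit vector, so level \<open>n\<close> has at most \<open>\<Delta> * sphere_card n\<close> of them.
\<close>

lemma sum_edge_diff_rearrangement_le:
  fixes v :: "nat \<Rightarrow> int ^ 'n"
  assumes v: "enumeration_respecting_l1 v" and f: "vanishes_at_infinity f" and p: "0 \<le> p"
    and F: "finite F" "F \<subseteq> edges"
  defines "\<Delta> \<equiv> real (sphere_card TYPE('n) 1)"
  obtains N where "(\<Sum>e\<in>F. edge_diff (rearrangement v f) e powr p)
    \<le> \<Delta> * (\<Sum>n<N. real (sphere_card TYPE('n) n) * (level_drop f n + level_drop f (Suc n)) powr p)"
proof -
  have "\<forall>e\<in>F. \<exists>x y. e = {x, y} \<and> adjacent x y \<and> l1_norm x \<le> l1_norm y"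
    using F edge_oriented by (metis subsetD)
  then obtain s t where st: "\<And>e. e \<in> F \<Longrightarrow> e = {s e, t e} \<and> adjacent (s e) (t e) \<and> l1_norm (s e) \<le> l1_norm (t e)"
    by metis
  define lev where "lev e = nat (l1_norm (s e))" for e
  have lev: "l1_norm (s e) = int (lev e)" for e
    by (simp add: lev_def)
  define b where "b n = (level_drop f n + level_drop f (Suc n)) powr p" for n
  have "finite (lev ` F)" using F by simp
  then obtain N where N: "lev ` F \<subseteq> {..<N}"
    using finite_nat_bounded by blast
  have "(\<Sum>e\<in>F. edge_diff (rearrangement v f) e powr p) \<le> (\<Sum>e\<in>F. b (lev e))"
  proof (rule sum_mono)
    fix e assume e: "e \<in> F"
    have "edge_diff (rearrangement v f) e \<le> level_drop f (lev e) + level_drop f (Suc (lev e))"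
      using edge_diff_rearrangement_le [OF v f _ lev] st [OF e] by metis
    then show "edge_diff (rearrangement v f) e powr p \<le> b (lev e)"
      unfolding b_def using e F p edge_diff_nonneg by (intro powr_mono2) auto
  qed
  also have "\<dots> = (\<Sum>n<N. \<Sum>e | e \<in> F \<and> lev e = n. b (lev e))"
    using F N by (intro sum.group [symmetric]) auto
  also have "\<dots> = (\<Sum>n<N. real (card {e \<in> F. lev e = n}) * b n)"
    by (intro sum.cong refl) simp
  also have "\<dots> \<le> (\<Sum>n<N. (\<Delta> * real (sphere_card TYPE('n) n)) * b n)"
  proof (intro sum_mono mult_right_mono)
    fix n
    let ?S = "{x :: int ^ 'n. l1_norm x = int n}" and ?Z = "{z :: int ^ 'n. l1_norm z = 1}"
    have "card {e \<in> F. lev e = n} \<le> card (?S \<times> ?Z)"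
    proof (rule card_inj_on_le [of "\<lambda>e. (s e, t e - s e)"])
      show "inj_on (\<lambda>e. (s e, t e - s e)) {e \<in> F. lev e = n}"
      proof (rule inj_onI)
        fix e e'
        assume "e \<in> {e \<in> F. lev e = n}" "e' \<in> {e \<in> F. lev e = n}" "(s e, t e - s e) = (s e', t e' - s e')"
        then have "e \<in> F" "e' \<in> F" "s e = s e'" "t e = t e'" by auto
        then show "e = e'" using st by metis
      qed
      show "(\<lambda>e. (s e, t e - s e)) ` {e \<in> F. lev e = n} \<subseteq> ?S \<times> ?Z"
        using st lev by (auto simp: adjacent_def l1_norm_minus_commute)
      show "finite (?S \<times> ?Z)"
        by (simp add: finite_l1_norm_eq)
    qed
    then have "card {e \<in> F. lev e = n} \<le> card ?Z * card ?S"
      by (simp add: card_cartesian_product mult.commute)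
    then show "real (card {e \<in> F. lev e = n}) \<le> \<Delta> * real (sphere_card TYPE('n) n)"
      unfolding \<Delta>_def sphere_card_def of_nat_mult [symmetric] of_nat_le_iff of_nat_1 .
  qed (simp add: b_def)
  also have "\<dots> = \<Delta> * (\<Sum>n<N. real (sphere_card TYPE('n) n) * b n)"
    by (simp add: sum_distrib_left mult.assoc)
  finally show ?thesis
    unfolding b_def by (rule that)
qed

section \<open>Comparison of the two gradients\<close>

lemma add_powr_le:
  fixes x y :: real
  assumes "0 \<le> x" "0 \<le> y" "0 \<le> p"
  shows "(x + y) powr p \<le> 2 powr p * (x powr p + y powr p)"
  using powr_sum_le [of "UNIV :: bool set" "\<lambda>b. if b then x else y" p] assms
  by (simp add: UNIV_bool add.commute)

text \<open>
  With \<open>\<Delta>\<close> the degree of the lattice and \<open>K\<close> the number of steps per level this is \<open>4 \<Delta> K\<^sup>2\<close>, that is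
  \<open>(2 \<Delta> K) (2 K)\<close>: the factor \<open>2 K\<close> occurs to the power \<open>p\<close> in the estimates, and \<open>2 \<Delta> K \<ge> 1\<close>
  occurs to the first power and is bounded by its \<open>p\<close>-th power.
\<close>

definition rearrangement_constant :: "'n::finite itself \<Rightarrow> real" where
  "rearrangement_constant TYPE('n) =
    4 * real (sphere_card TYPE('n) 1) * (32 * (real CARD('n))\<^sup>2)\<^sup>2"

text \<open>
  Chaining the upper bound for the rearrangement with the lower bound for \<open>f\<close>. The drop of the
  next level is weighted by \<open>sphere_card n\<close>, not by its own \<open>sphere_card (n + 1)\<close>; monotonicity of
  the sphere sizes allows the replacement.
\<close>

lemma sum_rearrangement_powr_le:
  fixes v :: "nat \<Rightarrow> int ^ 'n"
  assumes v: "enumeration_respecting_l1 v" and f: "vanishes_at_infinity f" and p: "1 \<le> p"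
    and F: "finite F" "F \<subseteq> edges"
  obtains U where "finite U" "U \<subseteq> edges"
    "(\<Sum>e\<in>F. edge_diff (rearrangement v f) e powr p)
      \<le> rearrangement_constant TYPE('n) powr p * (\<Sum>e\<in>U. edge_diff f e powr p)"
proof -
  define K where "K = 32 * (real CARD('n))\<^sup>2"
  define \<Delta> where "\<Delta> = real (sphere_card TYPE('n) 1)"
  define s where "s n = real (sphere_card TYPE('n) n)" for n
  define d where "d n = level_drop f n" for n
  have K: "1 \<le> K"
  proof -
    have "1 \<le> (real CARD('n))\<^sup>2"
      by (rule one_le_power) (simp add: Suc_le_eq)
    then show ?thesis unfolding K_def by linarith
  qed
  have \<Delta>: "1 \<le> \<Delta>"
    using sphere_card_pos [where 'n = 'n, of 1] by (simp add: \<Delta>_def)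
  have d: "0 \<le> d n" for n
    using level_drop_nonneg [OF f] by (simp add: d_def)
  have s: "0 \<le> s n" "s n \<le> s (Suc n)" for n
    using sphere_card_mono [where 'n = 'n, of n] by (simp_all add: s_def)
  obtain N where N: "(\<Sum>e\<in>F. edge_diff (rearrangement v f) e powr p)
      \<le> \<Delta> * (\<Sum>n<N. s n * (d n + d (Suc n)) powr p)"
    using sum_edge_diff_rearrangement_le [OF v f _ F, of p] p unfolding \<Delta>_def s_def d_def by auto
  define X where "X = (\<Sum>n<Suc N. s n * d n powr p)"
  obtain U where U: "finite U" "U \<subseteq> edges" "X \<le> K * K powr p * (\<Sum>e\<in>U. edge_diff f e powr p)"
    using sum_level_drop_le [OF f p, of "Suc N"] that unfolding X_def K_def s_def d_def by blast
  define Y where "Y = (\<Sum>e\<in>U. edge_diff f e powr p)"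
  have Y: "0 \<le> Y" by (simp add: Y_def sum_nonneg)
  have "(\<Sum>n<N. s n * (d n + d (Suc n)) powr p)
      \<le> (\<Sum>n<N. 2 powr p * (s n * d n powr p + s (Suc n) * d (Suc n) powr p))"
  proof (rule sum_mono)
    fix n
    have "s n * (d n + d (Suc n)) powr p \<le> s n * (2 powr p * (d n powr p + d (Suc n) powr p))"
      using s d p by (intro mult_left_mono add_powr_le) auto
    also have "\<dots> = 2 powr p * (s n * d n powr p + s n * d (Suc n) powr p)"
      by (simp add: algebra_simps)
    also have "\<dots> \<le> 2 powr p * (s n * d n powr p + s (Suc n) * d (Suc n) powr p)"
      using s by (intro mult_left_mono add_left_mono mult_right_mono) auto
    finally show "s n * (d n + d (Suc n)) powr p
        \<le> 2 powr p * (s n * d n powr p + s (Suc n) * d (Suc n) powr p)" .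
  qed
  also have "\<dots> = 2 powr p * ((\<Sum>n<N. s n * d n powr p) + (\<Sum>n<N. s (Suc n) * d (Suc n) powr p))"
    by (simp only: sum_distrib_left [symmetric] sum.distrib)
  also have "\<dots> \<le> 2 powr p * (X + X)"
  proof (intro mult_left_mono add_mono)
    show "(\<Sum>n<N. s n * d n powr p) \<le> X"
      using s by (simp add: X_def)
    show "(\<Sum>n<N. s (Suc n) * d (Suc n) powr p) \<le> X"
      using s unfolding X_def sum.lessThan_Suc_shift by simp
  qed simp
  also have "\<dots> \<le> 2 powr p * (2 * (K * K powr p * Y))"
    using U(3) by (simp add: Y_def)
  finally have "\<Delta> * (\<Sum>n<N. s n * (d n + d (Suc n)) powr p)
      \<le> \<Delta> * (2 powr p * (2 * (K * K powr p * Y)))"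
    using \<Delta> by (intro mult_left_mono) auto
  also have "\<dots> = (2 * \<Delta> * K) * ((2 * K) powr p * Y)"
    using K by (simp add: powr_mult)
  also have "\<dots> \<le> (2 * \<Delta> * K) powr p * ((2 * K) powr p * Y)"
  proof (rule mult_right_mono)
    have "1 \<le> 2 * \<Delta> * K"
      using mult_mono [OF \<Delta> K] \<Delta> by simp
    then show "2 * \<Delta> * K \<le> (2 * \<Delta> * K) powr p"
      using powr_mono [OF p, of "2 * \<Delta> * K"] by simp
  qed (use Y in simp)
  also have "\<dots> = (4 * \<Delta> * K\<^sup>2) powr p * Y"
    using K \<Delta> powr_mult [of "2 * \<Delta> * K" "2 * K" p]
    by (simp add: power2_eq_square mult_ac)
  finally show ?thesis
    using N U by (intro that [of U]) (auto simp: rearrangement_constant_def Y_def K_def \<Delta>_def)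
qed

lemma edge_diff_rearrangement_le_sup:
  fixes v :: "nat \<Rightarrow> int ^ 'n"
  assumes v: "enumeration_respecting_l1 v" and f: "vanishes_at_infinity f" and e: "e \<in> edges"
    and M: "\<And>e. e \<in> edges \<Longrightarrow> edge_diff f e \<le> M" "0 \<le> M"
  shows "edge_diff (rearrangement v f) e \<le> rearrangement_constant TYPE('n) * M"
proof -
  define K where "K = 32 * (real CARD('n))\<^sup>2"
  define \<Delta> where "\<Delta> = real (sphere_card TYPE('n) 1)"
  have K: "1 \<le> K"
  proof -
    have "1 \<le> (real CARD('n))\<^sup>2"
      by (rule one_le_power) (simp add: Suc_le_eq)
    then show ?thesis unfolding K_def by linarith
  qed
  have \<Delta>: "1 \<le> \<Delta>"
    using sphere_card_pos [where 'n = 'n, of 1] by (simp add: \<Delta>_def)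
  have drop: "level_drop f n \<le> K * M" for n
    unfolding K_def by (rule level_drop_le_sup [OF f M])
  obtain x y where xy: "e = {x, y}" "adjacent x y" "l1_norm x \<le> l1_norm y"
    using e by (rule edge_oriented)
  obtain n where n: "l1_norm x = int n"
    using nonneg_int_cases [OF l1_norm_nonneg] by metis
  have "edge_diff (rearrangement v f) e \<le> 2 * K * M"
    using edge_diff_rearrangement_le [OF v f xy(2) n xy(3)] drop [of n] drop [of "Suc n"]
    by (simp add: xy(1))
  also have "\<dots> \<le> 4 * \<Delta> * K\<^sup>2 * M"
  proof (rule mult_right_mono [OF _ M(2)])
    have "1 * K * 1 \<le> \<Delta> * K * K"
      using K \<Delta> by (intro mult_mono) auto
    moreover have "4 * \<Delta> * K\<^sup>2 = 4 * (\<Delta> * K * K)"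
      by (simp add: power2_eq_square)
    ultimately show "2 * K \<le> 4 * \<Delta> * K\<^sup>2"
      using K by linarith
  qed
  finally show ?thesis
    by (simp add: rearrangement_constant_def K_def \<Delta>_def)
qed

text \<open>
  Passage from finite sums of real numbers to the extended norm. The finite sets on both sides
  are unrelated: a rearrangement moves values arbitrarily far, so the edges on which \<open>f\<close> varies may
  lie far from those on which its rearrangement does.
\<close>

lemma grad_norm_finite_exponent_le:
  fixes f g :: "int ^ 'n \<Rightarrow> real"
  assumes p: "1 \<le> p" "p \<noteq> \<infinity>" and c: "0 < c"
    and le: "\<And>F. finite F \<Longrightarrow> F \<subseteq> edges \<Longrightarrow> \<exists>U. finite U \<and> U \<subseteq> edges \<and>
      (\<Sum>e\<in>F. edge_diff g e powr enn2real p) \<le> c powr enn2real p * (\<Sum>e\<in>U. edge_diff f e powr enn2real p)"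
  shows "grad_norm p g \<le> ennreal c * grad_norm p f"
proof -
  define r where "r = enn2real p"
  have "ennreal r = p"
    using p by (simp add: r_def less_top)
  then have r: "1 \<le> r"
    using p(1) by (metis ennreal_le_1 enn2real_nonneg ennreal_1 ennreal_le_iff r_def)
  define S where "S h = (\<Sum>\<^sub>\<infinity>e\<in>edges. ennreal (edge_diff h e powr r))" for h :: "int ^ 'n \<Rightarrow> real"
  have norm: "grad_norm p h = ennreal_powr (S h) (1 / r)" for h :: "int ^ 'n \<Rightarrow> real"
    using p by (simp add: grad_norm_def S_def r_def)
  have summable: "(\<lambda>e. ennreal (edge_diff h e powr r)) summable_on edges" for h :: "int ^ 'n \<Rightarrow> real"
    by (rule nonneg_summable_on_complete) simp
  have S_le: "S g \<le> ennreal (c powr r) * S f"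
    unfolding S_def [of g]
  proof (rule infsum_le_finite_sums [OF summable])
    fix F :: "(int ^ 'n) set set"
    assume "finite F" "F \<subseteq> edges"
    then obtain U where U: "finite U" "U \<subseteq> edges"
      and FU: "(\<Sum>e\<in>F. edge_diff g e powr r) \<le> c powr r * (\<Sum>e\<in>U. edge_diff f e powr r)"
      using le unfolding r_def by metis
    have "(\<Sum>e\<in>F. ennreal (edge_diff g e powr r)) \<le> ennreal (c powr r) * (\<Sum>e\<in>U. ennreal (edge_diff f e powr r))"
      using FU by (simp add: sum_ennreal ennreal_mult' [symmetric] ennreal_leI)
    also have "(\<Sum>e\<in>U. ennreal (edge_diff f e powr r)) \<le> S f"
      unfolding S_def using U by (subst nonneg_infsum_complete) (simp, rule SUP_upper, simp)
    finally show "(\<Sum>e\<in>F. ennreal (edge_diff g e powr r)) \<le> ennreal (c powr r) * S f"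
      by (simp add: mult_left_mono)
  qed
  show ?thesis
  proof (cases "S f = top")
    case True
    then show ?thesis
      using c by (simp add: norm ennreal_powr_def ennreal_mult_top)
  next
    case False
    define x where "x = enn2real (S f)"
    have x: "S f = ennreal x" "0 \<le> x"
      using False by (simp_all add: x_def less_top)
    have le': "S g \<le> ennreal (c powr r * x)"
      using S_le by (simp add: x ennreal_mult)
    then have fin: "S g \<noteq> top"
      by (auto simp: top_unique)
    have "enn2real (S g) \<le> c powr r * x"
      using le' x by (intro enn2real_leI) auto
    then have "enn2real (S g) powr (1 / r) \<le> (c powr r * x) powr (1 / r)"
      using r by (intro powr_mono2) auto
    also have "\<dots> = c * x powr (1 / r)"
      using c x r by (simp add: powr_mult powr_powr)
    finally have "ennreal (enn2real (S g) powr (1 / r)) \<le> ennreal c * ennreal (x powr (1 / r))"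
      using c by (simp add: ennreal_mult [symmetric] ennreal_leI)
    then show ?thesis
      using fin False by (simp add: norm ennreal_powr_def x_def)
  qed
qed

theorem corollary1p7:
  shows "\<exists>c::real. 0 < c \<and>
    (\<forall>(v :: nat \<Rightarrow> int ^ 'n) (p :: ennreal) (f :: int ^ 'n \<Rightarrow> real).
       enumeration_respecting_l1 v \<longrightarrow> 1 \<le> p \<longrightarrow> vanishes_at_infinity f \<longrightarrow>
       grad_norm p (rearrangement v f) \<le> ennreal c * grad_norm p f)"
proof (intro exI conjI allI impI)
  let ?c = "rearrangement_constant TYPE('n)"
  show c: "0 < ?c"
    using sphere_card_pos [where 'n = 'n, of 1] by (simp add: rearrangement_constant_def)
  fix v :: "nat \<Rightarrow> int ^ 'n" and p :: ennreal and f :: "int ^ 'n \<Rightarrow> real"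
  assume v: "enumeration_respecting_l1 v" and p: "1 \<le> p" and f: "vanishes_at_infinity f"
  show "grad_norm p (rearrangement v f) \<le> ennreal ?c * grad_norm p f"
  proof (cases "p = \<infinity>")
    case False
    then have "p < top" by (simp add: less_top)
    then have "1 \<le> enn2real p"
      using p enn2real_mono [of 1 p] by simp
    then show ?thesis
      using sum_rearrangement_powr_le [OF v f] by (intro grad_norm_finite_exponent_le p False c) metis
  next
    case True
    define S where "S = (SUP e\<in>edges. ennreal (edge_diff f e))"
    have "(SUP e\<in>edges. ennreal (edge_diff (rearrangement v f) e)) \<le> ennreal ?c * S"
    proof (cases "S = top")
      case False
      then have S: "ennreal (enn2real S) = S" by (simp add: less_top)
      have M: "edge_diff f e \<le> enn2real S" if "e \<in> edges" for e
      proof -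
        have "ennreal (edge_diff f e) \<le> ennreal (enn2real S)"
          unfolding S unfolding S_def using that by (rule SUP_upper)
        then show ?thesis by (simp add: ennreal_le_iff)
      qed
      show ?thesis
      proof (rule SUP_least)
        fix e :: "(int ^ 'n) set"
        assume "e \<in> edges"
        then have "edge_diff (rearrangement v f) e \<le> ?c * enn2real S"
          using edge_diff_rearrangement_le_sup [OF v f _ M] by simp
        then have "ennreal (edge_diff (rearrangement v f) e) \<le> ennreal ?c * ennreal (enn2real S)"
          using c by (simp add: ennreal_mult [symmetric] ennreal_leI)
        then show "ennreal (edge_diff (rearrangement v f) e) \<le> ennreal ?c * S"
          by (simp only: S)
      qed
    qed (use c in \<open>simp add: ennreal_mult_top\<close>)
    then show ?thesis
      by (simp add: grad_norm_def True S_def)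
  qed
qed

end
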